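(* Let $n \geq 2$ be an integer, let $0 < C < D$, and let $E = \bigcup_{j=1}^n e^{i 2 \pi j / n} [C, D]$. Then $$\Phi(z) = z \Big( \frac{1}{2} + \frac{\sqrt{D}^n \sqrt{C}^n}{2} \frac{1}{z^n} \pm \frac{1}{2 z^n} \sqrt{(z^n - C^n)(z^n - D^n)} \Big)^{\frac{1}{n}}$$ is the lemniscatic map of $E$, with corresponding lemniscatic domain $$\mathcal{L} = \left\{ w \in \widehat{\mathbb{C}} : |U(w)| = \left| w^n - \frac{(\sqrt{D}^n + \sqrt{C}^n)^2}{4} \right|^{\frac{1}{n}} > \mu = \Big( \frac{D^n - C^n}{4} \Big)^{\frac{1}{n}} \right\}.$$ Here the branch $\pm\sqrt{(z^n-C^n)(z^n-D^n)}$ is chosen such that $$\left| \frac{2}{D^n - C^n} \Big( z^n - \frac{D^n + C^n}{2} \pm \sqrt{(z^n - C^n)(z^n - D^n)} \Big) \right| > 1 \quad \text{for } z \in \mathbb{C}\setminus E.$$ The inverse of $\Phi$ is given by $$\Phi^{-1}(w) = w \left( 1 + \frac{(\sqrt{D}^n - \sqrt{C}^n)^2}{4} \, \frac{1}{w^n - \frac{(\sqrt{D}^n + \sqrt{C}^n)^2}{4}} \right)^{\frac{1}{n}}.$$ In both formulas the principal branch of the $n$th root is taken.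
   Context: $\widehat{\mathbb{C}} = \mathbb{C} \cup \{\infty\}$ is the extended complex plane; $[C,D]$ is the real interval and $e^{i\theta}[C,D]$ its rotation; $\sqrt{D}^n = (\sqrt{D})^n$. A lemniscatic domain is a domain of the form $\mathcal{L} = \{ w \in \widehat{\mathbb{C}} : |U(w)| > \mu \}$ (containing $\infty$) with $U(w) = \prod_{j=1}^N (w - a_j)^{m_j}$, where $a_1, \dots, a_N \in \mathbb{C}$ are pairwise distinct, $m_1, \dots, m_N > 0$ are real with $\sum_{j=1}^N m_j = 1$, and $\mu > 0$. The function $U$ is in general multiple-valued, but $|U(w)| = \prod_j |w-a_j|^{m_j}$ is single-valued. A compact set in $\mathbb{C}$ is called simply connected if it is connected and its complement in $\widehat{\mathbb{C}}$ is connected. If $E = \bigcup_{j=1}^N E_j$ with $E_1, \dots, E_N \subseteq \mathbb{C}$ mutually exterior simply connected compact sets (none a single point), and $\mathcal{K} = \widehat{\mathbb{C}} \setminus E$, then by a theorem of Walsh there exist a unique lemniscatic domain $\mathcal{L}$ (with $N$ points $a_j$) and a unique bijective conformal map $\Phi : \mathcal{K} \to \mathcal{L}$ with $\Phi(z) = z + \mathcal{O}(1/z)$ for $z$ near infinity (in particular $\Phi(\infty)=\infty$). This $\Phi$ is called the lemniscatic map of $\mathcal{K}$ (or of $E$), and $\mathcal{L}$ its corresponding lemniscatic domain. The formula for $\Phi$ is understood at $z = 0$ and $z = \infty$ through its analytic (respectively meromorphic) extension, so that $\Phi(0)=0$ and $\Phi(\infty)=\infty$; likewise $\Phi^{-1}(\infty)=\infty$.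 *)

theory Defs
  imports "HOL-Analysis.Analysis" "HOL-Library.Landau_Symbols"
begin

section \<open>The extended complex plane\<close>

text \<open>
  Points of the extended plane are elements of \<^typ>\<open>complex option\<close>, with \<^term>\<open>None\<close> as the
  point at infinity; the topology is that of the one-point compactification.
\<close>

abbreviation riemann_sphere :: "complex option topology" where
  "riemann_sphere \<equiv> Alexandroff_compactification euclidean"

definition sphere_compl :: "complex set \<Rightarrow> complex option set" where
  "sphere_compl E = UNIV - Some ` E"

text \<open>
  The two charts \<open>z\<close> and \<open>1/z\<close> and the corresponding parametrisations, selected by the first
  argument: the chart \<open>z\<close> around a finite point, the chart \<open>1/z\<close> around infinity.
  The value \<open>0\<close> of the chart \<open>z\<close> at infinity, and of the chart \<open>1/z\<close> at \<open>0\<close>, is a dummy.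
\<close>

fun sphere_chart :: "complex option \<Rightarrow> complex option \<Rightarrow> complex" where
  "sphere_chart (Some p) q = (case q of None \<Rightarrow> 0 | Some z \<Rightarrow> z)"
| "sphere_chart None q = (case q of None \<Rightarrow> 0 | Some z \<Rightarrow> 1 / z)"

fun sphere_param :: "complex option \<Rightarrow> complex \<Rightarrow> complex option" where
  "sphere_param (Some p) t = Some t"
| "sphere_param None t = (if t = 0 then None else Some (1 / t))"

text \<open>
  Holomorphic maps into the sphere, for an open set \<open>S\<close>. By continuity, near \<open>p\<close> the map
  stays in the domain of the chart around \<open>f p\<close>, so the dummy values above play no role.
\<close>

definition sphere_holomorphic_on ::
    "(complex option \<Rightarrow> complex option) \<Rightarrow> complex option set \<Rightarrow> bool" where
  "sphere_holomorphic_on f S \<longleftrightarrow>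
     openin riemann_sphere S \<and>
     continuous_map (subtopology riemann_sphere S) riemann_sphere f \<and>
     (\<forall>p\<in>S. (\<lambda>t. sphere_chart (f p) (f (sphere_param p t))) analytic_on {sphere_chart p p})"

text \<open>A holomorphic bijection is conformal: its local derivatives do not vanish.\<close>

definition conformal_bij ::
    "(complex option \<Rightarrow> complex option) \<Rightarrow> complex option set \<Rightarrow> complex option set \<Rightarrow> bool" where
  "conformal_bij f S T \<longleftrightarrow> sphere_holomorphic_on f S \<and> bij_betw f S T"

section \<open>Lemniscatic domains and lemniscatic maps\<close>

text \<open>
  Not the library's \<^const>\<open>simply_connected\<close>, which is the homotopy notion.
\<close>

definition simply_connected_compact :: "complex set \<Rightarrow> bool" where
  "simply_connected_compact S \<longleftrightarrow>
     compact S \<and> connected S \<and> connectedin riemann_sphere (sphere_compl S)"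

text \<open>The single-valued modulus of the multiple-valued \<open>U(w) = (\<Prod>j<N. (w - a j) ^ m j)\<close>.\<close>

definition abs_U :: "nat \<Rightarrow> (nat \<Rightarrow> complex) \<Rightarrow> (nat \<Rightarrow> real) \<Rightarrow> complex \<Rightarrow> real" where
  "abs_U N a m w = (\<Prod>j<N. cmod (w - a j) powr m j)"

definition lemniscatic_params :: "nat \<Rightarrow> (nat \<Rightarrow> complex) \<Rightarrow> (nat \<Rightarrow> real) \<Rightarrow> real \<Rightarrow> bool" where
  "lemniscatic_params N a m \<mu> \<longleftrightarrow>
     inj_on a {..<N} \<and> (\<forall>j<N. m j > 0) \<and> (\<Sum>j<N. m j) = 1 \<and> \<mu> > 0"

definition lemniscatic_domain ::
    "nat \<Rightarrow> (nat \<Rightarrow> complex) \<Rightarrow> (nat \<Rightarrow> real) \<Rightarrow> real \<Rightarrow> complex option set" where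
  "lemniscatic_domain N a m \<mu> = insert None (Some ` {w. abs_U N a m w > \<mu>})"

text \<open>
  The map \<open>\<Phi>\<close> is the lemniscatic map of \<open>E\<close>, a union of \<open>N\<close> mutually exterior simply connected
  compact sets, and its corresponding lemniscatic domain is the one given by \<open>N\<close>, \<open>a\<close>, \<open>m\<close>, \<open>\<mu>\<close>.
  Compact sets with connected complement are mutually exterior iff they are disjoint.
  Only the values of \<open>\<Phi>\<close> on the complement of \<open>E\<close> matter; there \<open>\<Phi>\<close> is injective, so
  \<open>\<Phi>\<close> is finite at all finite points and \<^const>\<open>the\<close> is harmless.
\<close>

definition lemniscatic_map ::
    "complex set \<Rightarrow> nat \<Rightarrow> (nat \<Rightarrow> complex) \<Rightarrow> (nat \<Rightarrow> real) \<Rightarrow> real \<Rightarrow>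
      (complex option \<Rightarrow> complex option) \<Rightarrow> bool" where
  "lemniscatic_map E N a m \<mu> \<Phi> \<longleftrightarrow>
     (\<exists>Es :: nat \<Rightarrow> complex set.
        E = (\<Union>j<N. Es j) \<and>
        (\<forall>j<N. simply_connected_compact (Es j) \<and> Es j \<noteq> {} \<and> (\<nexists>p. Es j = {p})) \<and>
        (\<forall>i<N. \<forall>j<N. i \<noteq> j \<longrightarrow> Es i \<inter> Es j = {})) \<and>
     lemniscatic_params N a m \<mu> \<and>
     conformal_bij \<Phi> (sphere_compl E) (lemniscatic_domain N a m \<mu>) \<and>
     \<Phi> None = None \<and>
     (\<lambda>z. the (\<Phi> (Some z)) - z) \<in> O[at_infinity](\<lambda>z. 1 / z)"

section \<open>Radial slits\<close>

definition slits :: "nat \<Rightarrow> real \<Rightarrow> real \<Rightarrow> complex set" where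
  "slits n C D =
     (\<Union>j\<in>{1..n}. (\<lambda>x. exp (\<i> * of_real (2 * pi * real j / real n)) * of_real x) ` {C..D})"

text \<open>The function \<open>s\<close> is the chosen branch, including its sign \<open>\<plusminus>\<close>, of the square root.\<close>

definition slit_branch :: "nat \<Rightarrow> real \<Rightarrow> real \<Rightarrow> (complex \<Rightarrow> complex) \<Rightarrow> bool" where
  "slit_branch n C D s \<longleftrightarrow>
     s holomorphic_on (- slits n C D) \<and>
     (\<forall>z\<in>- slits n C D.
        (s z)\<^sup>2 = (z ^ n - of_real (C ^ n)) * (z ^ n - of_real (D ^ n)) \<and>
        cmod (of_real (2 / (D ^ n - C ^ n)) * (z ^ n - of_real ((D ^ n + C ^ n) / 2) + s z)) > 1)"

text \<open>
  In both maps below \<open>powr (1 / n)\<close> is the principal branch of the \<open>n\<close>-th root. Due to the factor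
  \<open>z\<close>, the value of \<open>slit_Phi\<close> at \<open>0\<close> is \<open>0\<close>, as required for the analytic extension.
\<close>

definition slit_Phi ::
    "nat \<Rightarrow> real \<Rightarrow> real \<Rightarrow> (complex \<Rightarrow> complex) \<Rightarrow> complex option \<Rightarrow> complex option" where
  "slit_Phi n C D s = map_option (\<lambda>z.
     z * (1 / 2 + of_real (sqrt D ^ n * sqrt C ^ n / 2) * (1 / z ^ n) + 1 / (2 * z ^ n) * s z)
           powr (1 / of_nat n))"

definition slit_Phi_inv :: "nat \<Rightarrow> real \<Rightarrow> real \<Rightarrow> complex option \<Rightarrow> complex option" where
  "slit_Phi_inv n C D = map_option (\<lambda>w.
     w * (1 + of_real ((sqrt D ^ n - sqrt C ^ n)\<^sup>2 / 4)
               * (1 / (w ^ n - of_real ((sqrt D ^ n + sqrt C ^ n)\<^sup>2 / 4))))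
           powr (1 / of_nat n))"

end

theory Submission
  imports Defs "HOL-Complex_Analysis.Cauchy_Integral_Formula"
begin

text \<open>
  Put \<open>u = z ^ n\<close>, which maps the slits onto \<open>[C ^ n, D ^ n]\<close>. Off this segment the Joukowski relation
  \<open>x + q\<^sup>2 / x = u - (C ^ n + D ^ n) / 2\<close> with \<open>q = (D ^ n - C ^ n) / 4\<close> has exactly one root with
  \<open>\<bar>x\<bar> > q\<close>, and the branch condition on \<open>s\<close> says that \<open>(u - (C ^ n + D ^ n) / 2 + s) / 2\<close> is that root.
  With \<open>A, B = (sqrt D ^ n \<plusminus> sqrt C ^ n)\<^sup>2 / 4\<close> one has \<open>A * B = q\<^sup>2\<close> and \<open>A + B = (C ^ n + D ^ n) / 2\<close>,
  so \<open>u = (x + A) * (1 + B / x)\<close> and the map becomes \<open>\<Phi>(z) = z * (1 + B / x) powr (- 1 / n)\<close>, with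
  \<open>\<Phi>(z) ^ n - A = x\<close>. As \<open>B < q < \<bar>x\<bar>\<close>, the base \<open>1 + B / x\<close> lies in the right half-plane, so the
  principal root causes no monodromy and \<open>w * (1 + B / (w ^ n - A)) powr (1 / n)\<close> is an inverse.
\<close>

section \<open>Maps of the Riemann sphere fixing infinity\<close>

lemma sphere_compl_eq: "sphere_compl E = insert None (Some ` (- E))"
proof -
  have "x \<in> insert None (Some ` (- E))" if "x \<notin> Some ` E" for x
    using that by (cases x) auto
  then show ?thesis
    by (auto simp: sphere_compl_def)
qed

text \<open>Two kinds of open sets of the sphere have to be pulled back: open sets of the plane,
  where continuity suffices, and complements of compact sets, where growth at infinity keeps the
  preimage of the compact set bounded.\<close>

lemma continuous_map_sphere_map_option:
  assumes E: "compact E" and cont: "continuous_on (- E) f"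
    and inf: "filterlim f at_infinity at_infinity"
  shows "continuous_map (subtopology riemann_sphere (sphere_compl E)) riemann_sphere (map_option f)"
  unfolding continuous_map_def
proof (intro conjI strip)
  have opE: "open (- E)"
    using E by (simp add: compact_imp_closed open_Compl)
  have op: "open {z. z \<notin> E \<and> f z \<in> U}" if "open U" for U
    using continuous_open_preimage [OF cont opE that] by (simp add: vimage_def Int_def)
  have tops: "topspace (subtopology riemann_sphere (sphere_compl E)) = sphere_compl E"
    by (auto simp: sphere_compl_eq)
  fix V assume "openin riemann_sphere V"
  then consider U where "open U" "V = Some ` U"
    | K where "compact K" "V = insert None (Some ` (- K))"
    by (auto simp: openin_Alexandroff_compactification Compl_eq_Diff_UNIV)
  then have "openin riemann_sphere {x \<in> sphere_compl E. map_option f x \<in> V}"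
  proof cases
    case 1
    then have "{x \<in> sphere_compl E. map_option f x \<in> V} = Some ` {z. z \<notin> E \<and> f z \<in> U}"
      by (auto simp: sphere_compl_eq)
    then show ?thesis
      using op [OF \<open>open U\<close>] by simp
  next
    case 2
    \<comment> \<open>\<open>?K\<close> is \<open>E\<close> together with the points that
      \<open>f\<close> sends into \<open>K\<close>. Beyond radius \<open>b\<close> the values of
      \<open>f\<close> are too large to lie in \<open>K\<close>, so \<open>?K\<close> is bounded;
      its complement is open by \<open>op\<close>.\<close>
    let ?K = "- {z. z \<notin> E \<and> f z \<in> - K}"
    obtain M where M: "M > 0" "\<And>w. w \<in> K \<Longrightarrow> cmod w < M"
      using compact_imp_bounded [OF \<open>compact K\<close>] bounded_pos_less by blast
    have "\<forall>\<^sub>F z in at_infinity. cmod (f z) \<ge> M"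
      using inf M by (auto simp: filterlim_at_infinity [of 0])
    then obtain b where b: "\<And>z. cmod z \<ge> b \<Longrightarrow> cmod (f z) \<ge> M"
      by (auto simp: eventually_at_infinity)
    have "z \<in> E \<union> cball 0 b" if "z \<in> ?K" for z
      using that M(2) [of "f z"] b [of z] by (cases "cmod z \<ge> b") auto
    then have "?K \<subseteq> E \<union> cball 0 b"
      by blast
    then have "bounded ?K"
      by (rule bounded_subset [rotated]) (simp add: compact_imp_bounded [OF E])
    moreover have "closed ?K"
      unfolding closed_def double_complement
      using \<open>compact K\<close> by (intro op open_Compl compact_imp_closed)
    ultimately have "compact ?K"
      by (simp add: compact_eq_bounded_closed)
    moreover have "{x \<in> sphere_compl E. map_option f x \<in> V} = insert None (Some ` (UNIV - ?K))"
      using 2 by (auto simp: sphere_compl_eq)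
    ultimately show ?thesis
      by (auto simp: openin_Alexandroff_compactification compact_imp_closed)
  qed
  then show "openin (subtopology riemann_sphere (sphere_compl E))
      {x \<in> topspace (subtopology riemann_sphere (sphere_compl E)). map_option f x \<in> V}"
    unfolding tops openin_subtopology by (intro exI conjI) auto
qed auto

text \<open>At finite points the chart expression is \<open>f\<close> itself. At infinity it is
  \<open>1 / f (1 / t)\<close>, whose singularity at \<open>0\<close> is removable because
  \<open>f\<close> tends to infinity.\<close>

lemma sphere_holomorphic_on_map_option:
  assumes E: "compact E" and hol: "f holomorphic_on (- E)"
    and inf: "filterlim f at_infinity at_infinity"
  shows "sphere_holomorphic_on (map_option f) (sphere_compl E)"
  unfolding sphere_holomorphic_on_def
proof (intro conjI ballI)
  have opE: "open (- E)"
    using E by (simp add: compact_imp_closed open_Compl)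
  have "sphere_compl E = insert None (Some ` (UNIV - E))"
    by (simp add: sphere_compl_eq Compl_eq_Diff_UNIV)
  then show "openin riemann_sphere (sphere_compl E)"
    using E by (auto simp: openin_Alexandroff_compactification compact_imp_closed)
  show "continuous_map (subtopology riemann_sphere (sphere_compl E)) riemann_sphere (map_option f)"
    using assms by (intro continuous_map_sphere_map_option holomorphic_on_imp_continuous_on)
  fix p assume p: "p \<in> sphere_compl E"
  show "(\<lambda>t. sphere_chart (map_option f p) (map_option f (sphere_param p t)))
      analytic_on {sphere_chart p p}"
  proof (cases p)
    case (Some z)
    then have "f analytic_on {z}"
      using p opE hol by (auto simp: sphere_compl_eq analytic_at)
    with Some show ?thesis by simp
  next
    case None
    let ?g = "\<lambda>t. if t = 0 then 0 else 1 / f (1 / t)"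
    have "\<forall>\<^sub>F z in at_infinity. cmod (f z) \<ge> 1"
      using inf by (auto simp: filterlim_at_infinity [of 0])
    then obtain b where b: "\<And>z. cmod z \<ge> b \<Longrightarrow> cmod (f z) \<ge> 1"
      by (auto simp: eventually_at_infinity)
    obtain M where M: "M > 0" "\<And>w. w \<in> E \<Longrightarrow> cmod w < M"
      using compact_imp_bounded [OF E] bounded_pos_less by blast
    define m where "m = max M b"
    have m: "m > 0" "m \<ge> M" "m \<ge> b"
      using M by (auto simp: m_def)
    \<comment> \<open>For \<open>0 < cmod t < r\<close> the point \<open>1 / t\<close> is so large
      that it avoids \<open>E\<close> and \<open>f\<close> does not vanish there; hence
      \<open>?g\<close> is holomorphic on the punctured disc.\<close>
    define r where "r = 1 / m"
    have r: "r > 0" using m by (simp add: r_def)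
    have large: "1 / t \<notin> E \<and> f (1 / t) \<noteq> 0" if "t \<noteq> 0" "cmod t < r" for t
    proof -
      have "cmod (1 / t) \<ge> m"
        using that m unfolding r_def norm_divide by (simp add: field_simps)
      then show ?thesis
        using M m b [of "1 / t"] by fastforce
    qed
    have lim: "(?g \<longlongrightarrow> 0) (at 0)"
    proof -
      have "filterlim (\<lambda>t. f (inverse t)) at_infinity (at 0)"
        using filterlim_compose [OF inf filterlim_inverse_at_infinity] .
      then have "((\<lambda>t. inverse (f (inverse t))) \<longlongrightarrow> 0) (at 0)"
        using tendsto_inverse_0 filterlim_compose by blast
      then show ?thesis
        by (rule Lim_transform_eventually) (auto simp: eventually_at_filter inverse_eq_divide)
    qed
    have "?g holomorphic_on ball 0 r"
    proof (rule no_isolated_singularity' [of "{0}"])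
      show "(?g \<longlongrightarrow> ?g z) (at z within ball 0 r)" if "z \<in> {0}" for z
        using lim that by (simp add: tendsto_within_subset [of _ _ 0 UNIV])
      have "(\<lambda>t. 1 / (f \<circ> (\<lambda>t. 1 / t)) t) holomorphic_on ball 0 r - {0}"
        by (intro holomorphic_intros holomorphic_on_compose_gen [OF _ hol])
          (use large in \<open>auto simp: o_def\<close>)
      then show "?g holomorphic_on ball 0 r - {0}"
        by (rule holomorphic_transform) auto
    qed auto
    then have "?g analytic_on {0}"
      by (rule holomorphic_on_imp_analytic_at) (use r in auto)
    moreover have "(\<lambda>t. sphere_chart None (map_option f (sphere_param None t))) = ?g"
      by (auto simp: fun_eq_iff)
    ultimately show ?thesis
      using None by simp
  qed
qed

text \<open>Infinity is a limit point of the plane complement because \<open>S\<close> and any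
  compact \<open>K\<close> together are bounded. A set between a connected set and its closure is
  connected.\<close>

lemma connectedin_sphere_compl:
  assumes "compact S" "connected (- S)"
  shows "connectedin riemann_sphere (sphere_compl S)"
proof (rule connectedin_intermediate_closure_of)
  show "connectedin riemann_sphere (Some ` (- S))"
    using assms by (intro connectedin_continuous_map_image [OF continuous_map_Some]) auto
  show "Some ` (- S) \<subseteq> sphere_compl S"
    by (auto simp: sphere_compl_eq)
  have "\<exists>y\<in>Some ` (- S). y \<in> T" if T: "None \<in> T" "openin riemann_sphere T" for T
  proof -
    obtain K where K: "compact K" "T = insert None (Some ` (- K))"
      using T by (auto simp: openin_Alexandroff_compactification Compl_eq_Diff_UNIV)
    have "bounded (S \<union> K)"
      using K assms by (auto simp: compact_imp_bounded)
    then obtain z where "z \<notin> S \<union> K"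
      using not_bounded_UNIV by (metis UNIV_eq_I)
    with K show ?thesis by auto
  qed
  then have "None \<in> riemann_sphere closure_of (Some ` (- S))"
    by (auto simp: in_closure_of)
  moreover have "Some ` (- S) \<subseteq> riemann_sphere closure_of (Some ` (- S))"
    by (intro closure_of_subset) auto
  moreover have "sphere_compl S = insert None (Some ` (- S))"
    by (simp add: sphere_compl_eq)
  ultimately show "sphere_compl S \<subseteq> riemann_sphere closure_of (Some ` (- S))"
    by simp
qed

section \<open>Roots of unity and radial slits\<close>

text \<open>Both sides are monic polynomials of degree \<open>n\<close> in \<open>w\<close> that
  agree at the \<open>n\<close> roots of \<open>c\<close>, so their difference has smaller degree
  and too many zeros.\<close>

lemma prod_diff_nth_roots:
  fixes c w :: complex
  assumes "n > 0" "c \<noteq> 0"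
  shows "(\<Prod>z | z ^ n = c. w - z) = w ^ n - c"
proof -
  let ?A = "{z. z ^ n = c}"
  let ?q = "\<Prod>z\<in>?A. [:- z, 1:]"
  have card: "card ?A = n" and fin: "finite ?A"
    using assms by (auto simp: card_nth_roots finite_nth_roots)
  have deg: "degree ?q = n"
    using card by (subst degree_prod_eq_sum_degree) auto
  have "lead_coeff ?q = 1"
    by (simp add: lead_coeff_prod)
  then have lead: "coeff ?q n = 1"
    using deg by simp
  have "monom 1 n - [:c:] = ?q"
  proof (rule poly_eqI_degree_lead_coeff [of _ n])
    show "coeff (monom 1 n - [:c:]) n = coeff ?q n"
      using assms lead by (simp add: coeff_pCons split: nat.split)
    show "degree (monom 1 n - [:c:]) \<le> n"
      by (intro degree_diff_le) (auto simp: degree_monom_le)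
    show "poly (monom 1 n - [:c:]) z = poly ?q z" if "z \<in> ?A" for z
      using that fin by (auto simp: poly_monom poly_prod)
  qed (use card deg in auto)
  then have "poly (monom 1 n - [:c:]) w = poly ?q w"
    by simp
  then show ?thesis
    by (simp add: poly_monom poly_prod)
qed

text \<open>The angles for \<open>j = n\<close> and \<open>j = 0\<close> coincide; the shifted index
  range is the usual one for roots of unity.\<close>

lemma slits_eq:
  assumes "n > 0"
  shows "slits n C D =
    (\<Union>j<n. (\<lambda>x. cis (2 * pi * real j / real n) * of_real x) ` {C..D})"
proof -
  let ?r = "\<lambda>j. cis (2 * pi * real j / real n)"
  have "{1..n} = insert n {1..<n}" "{..<n} = insert 0 {1..<n}"
    using assms by auto
  moreover have "?r n = ?r 0"
    using assms by simp
  ultimately have "?r ` {1..n} = ?r ` {..<n}"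
    by simp
  then have "(\<Union>w\<in>?r ` {1..n}. (\<lambda>x. w * of_real x) ` {C..D}) =
      (\<Union>w\<in>?r ` {..<n}. (\<lambda>x. w * of_real x) ` {C..D})"
    by simp
  then show ?thesis
    by (simp add: slits_def cis_conv_exp)
qed

lemma mem_slits_iff:
  assumes "n > 0" "0 < C" "C \<le> D"
  shows "z \<in> slits n C D \<longleftrightarrow> z ^ n \<in> of_real ` {C ^ n..D ^ n}"
proof
  assume "z \<in> slits n C D"
  then obtain j where "z \<in> (\<lambda>x. cis (2 * pi * real j / real n) * of_real x) ` {C..D}"
    unfolding slits_eq [OF \<open>n > 0\<close>] by blast
  then obtain x where x: "C \<le> x" "x \<le> D" "z = cis (2 * pi * real j / real n) * of_real x"
    by (elim imageE) simp
  have "cis (2 * pi * real j / real n) ^ n = cis (2 * pi * real j)"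
    using assms unfolding Complex.DeMoivre by simp
  then have "z ^ n = of_real (x ^ n)"
    using x by (simp add: power_mult_distrib)
  moreover have "x ^ n \<in> {C ^ n..D ^ n}"
    using x assms by (simp add: power_mono)
  ultimately show "z ^ n \<in> of_real ` {C ^ n..D ^ n}"
    by blast
next
  assume "z ^ n \<in> of_real ` {C ^ n..D ^ n}"
  then obtain y where y: "C ^ n \<le> y" "y \<le> D ^ n" "z ^ n = of_real y"
    by auto
  \<comment> \<open>The positive real root is the modulus of \<open>z\<close>, and
    \<open>z / x\<close> is then a root of unity that gives the direction of the slit.\<close>
  define x where "x = root n y"
  have "0 < C ^ n"
    using assms by simp
  then have "0 < y"
    using y(1) by (rule less_le_trans)
  then have xn: "x ^ n = y" and x0: "x > 0"
    using assms by (auto simp: x_def)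
  have x: "C \<le> x" "x \<le> D"
    using y xn x0 assms power_mono_iff [of C x n] power_mono_iff [of x D n] by simp_all
  have "(z / of_real x) ^ n = 1"
    using y \<open>0 < y\<close> xn x0 assms by (simp add: power_divide flip: of_real_power)
  then have "z / of_real x \<in> (\<lambda>j. cis (2 * pi * real j / real n)) ` {..<n}"
    unfolding bij_betw_imp_surj_on [OF Complex.bij_betw_roots_unity [OF \<open>n > 0\<close>]] by simp
  then obtain j where "j < n" "z / of_real x = cis (2 * pi * real j / real n)"
    by (elim imageE) simp
  then have "z = cis (2 * pi * real j / real n) * of_real x"
    using x0 by (simp add: field_simps)
  then have "z \<in> (\<lambda>x. cis (2 * pi * real j / real n) * of_real x) ` {C..D}"
    using x by (intro image_eqI [of _ _ x]) auto
  with \<open>j < n\<close> show "z \<in> slits n C D"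
    unfolding slits_eq [OF \<open>n > 0\<close>] by blast
qed

lemma compact_slits: "compact (slits n C D)"
  unfolding slits_def
  by (intro compact_UN compact_continuous_image continuous_intros) auto

text \<open>A common point has one modulus, so \<open>x = y\<close>; cancelling it leaves two equal
  roots of unity with different indices.\<close>

lemma disjoint_rotated_segments:
  assumes "n > 0" "0 < C" "i < n" "j < n" "i \<noteq> j"
  shows "(\<lambda>x. cis (2 * pi * real i / real n) * of_real x) ` {C..D} \<inter>
    (\<lambda>x. cis (2 * pi * real j / real n) * of_real x) ` {C..D} = {}"
proof -
  have False if x: "C \<le> x" "C \<le> y"
    and eq: "cis (2 * pi * real i / real n) * of_real x = cis (2 * pi * real j / real n) * of_real y" for x y
  proof -
    have "x = y"
      using arg_cong [OF eq, of cmod] x assms by (simp add: norm_mult)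
    then have "cis (2 * pi * real i / real n) = cis (2 * pi * real j / real n)"
      using eq x assms by auto
    then show False
      using assms bij_betw_imp_inj_on [OF Complex.bij_betw_roots_unity [OF \<open>n > 0\<close>]]
      by (auto simp: inj_on_def)
  qed
  then show ?thesis by fastforce
qed

section \<open>The Joukowski coordinate of a slit\<close>

lemma csqrt_Re_pos:
  assumes "w \<notin> \<real>\<^sub>\<le>\<^sub>0"
  shows "Re (csqrt w) > 0"
proof (rule ccontr)
  assume "\<not> Re (csqrt w) > 0"
  then have "Re (csqrt w) = 0"
    using Re_csqrt [of w] by linarith
  then have "(csqrt w)\<^sup>2 \<in> \<real>\<^sub>\<le>\<^sub>0"
    by (auto simp: complex_nonpos_Reals_iff power2_eq_square)
  with assms show False by simp
qed

text \<open>The imaginary axis is the perpendicular bisector of \<open>-1\<close> and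
  \<open>1\<close>. Consequently \<open>(1 + r) / (1 - r)\<close> maps the right half-plane without
  \<open>1\<close> to the exterior of the unit circle.\<close>

lemma cmod_one_minus_less_iff: "cmod (1 - r) < cmod (1 + r) \<longleftrightarrow> Re r > 0"
proof -
  have "cmod (1 - r) < cmod (1 + r) \<longleftrightarrow> (cmod (1 - r))\<^sup>2 < (cmod (1 + r))\<^sup>2"
    by (simp flip: not_le)
  also have "\<dots> \<longleftrightarrow> Re r > 0"
    unfolding cmod_power2 by (simp add: power2_eq_square algebra_simps)
  finally show ?thesis .
qed

lemma Re_pos_square_notin_nonpos_Reals:
  assumes "Re r > 0"
  shows "r\<^sup>2 \<notin> \<real>\<^sub>\<le>\<^sub>0"
proof
  assume "r\<^sup>2 \<in> \<real>\<^sub>\<le>\<^sub>0"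
  then have "Im r = 0" "(Re r)\<^sup>2 \<le> (Im r)\<^sup>2"
    using assms by (auto simp: complex_nonpos_Reals_iff power2_eq_square)
  with assms show False by simp
qed

text \<open>
  The inverse of the Joukowski map on the exterior of the circle. Since \<open>r\<close> lies in the right half-plane
  off the segment, holomorphy and the lower bound on the modulus can both be read off.
\<close>

definition slit_coord :: "real \<Rightarrow> real \<Rightarrow> complex \<Rightarrow> complex" where
  "slit_coord c d u =
     (let r = csqrt ((u - of_real d) / (u - of_real c)) in of_real ((d - c) / 4) * (1 + r) / (1 - r))"

text \<open>If the ratio equals \<open>t \<le> 0\<close>, solving for \<open>u\<close> gives
  \<open>(d - t * c) / (1 - t)\<close>, a convex combination of \<open>d\<close> and
  \<open>c\<close> with weights \<open>1 / (1 - t)\<close> and \<open>- t / (1 - t)\<close>.\<close>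

lemma slit_ratio_notin_nonpos_Reals:
  fixes c d :: real and u :: complex
  assumes "c < d" "u \<notin> of_real ` {c..d}"
  shows "(u - of_real d) / (u - of_real c) \<notin> \<real>\<^sub>\<le>\<^sub>0"
proof
  assume "(u - of_real d) / (u - of_real c) \<in> \<real>\<^sub>\<le>\<^sub>0"
  then obtain t where t: "t \<le> 0" "(u - of_real d) / (u - of_real c) = of_real t"
    by (auto elim: nonpos_Reals_cases)
  have "u \<noteq> of_real c"
    using assms by auto
  then have "u - of_real d = (u - of_real d) / (u - of_real c) * (u - of_real c)"
    by simp
  then have "u - of_real d = of_real t * (u - of_real c)"
    using t by simp
  then have "u * of_real (1 - t) = of_real (d - t * c)"
    by (simp add: algebra_simps)
  moreover have "complex_of_real (1 - t) \<noteq> 0"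
    using t(1) unfolding of_real_eq_0_iff by linarith
  ultimately have "u = of_real (d - t * c) / of_real (1 - t)"
    using nonzero_eq_divide_eq by blast
  then have "u = of_real ((d - t * c) / (1 - t))"
    by (simp only: of_real_divide)
  moreover have "t * d \<le> t * c"
    using t assms by (simp add: mult_left_mono_neg)
  then have "(d - t * c) / (1 - t) \<in> {c..d}"
    using t assms by (simp add: field_simps)
  ultimately show False
    using assms by blast
qed

lemma
  fixes c d :: real
  assumes "c < d" "u \<notin> of_real ` {c..d}"
  shows cmod_slit_coord: "cmod (slit_coord c d u) > (d - c) / 4" (is ?A)
    and joukowski_slit_coord:
      "slit_coord c d u + (of_real ((d - c) / 4))\<^sup>2 / slit_coord c d u = u - of_real ((c + d) / 2)" (is ?B)
proof -
  define q :: complex where "q = of_real ((d - c) / 4)"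
  define r where "r = csqrt ((u - of_real d) / (u - of_real c))"
  have "Re r > 0"
    unfolding r_def using assms by (intro csqrt_Re_pos slit_ratio_notin_nonpos_Reals)
  then have less: "cmod (1 - r) < cmod (1 + r)"
    by (simp add: cmod_one_minus_less_iff)
  have uc: "u - of_real c \<noteq> 0"
    using assms by auto
  have r2: "u - of_real d = r\<^sup>2 * (u - of_real c)"
    using uc by (simp add: r_def)
  have q: "q \<noteq> 0" and dc: "of_real d = of_real c + 4 * q"
    using assms by (auto simp: q_def field_simps)
  have "r \<noteq> 1"
    using r2 dc q by auto
  have "r \<noteq> -1"
    using \<open>Re r > 0\<close> by auto
  have x: "slit_coord c d u = q * (1 + r) / (1 - r)"
    by (simp add: slit_coord_def q_def r_def Let_def)
  have nz: "1 - r \<noteq> 0" "1 + r \<noteq> 0"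
    using \<open>r \<noteq> 1\<close> \<open>r \<noteq> -1\<close> by (auto simp: eq_neg_iff_add_eq_0 add.commute)
  have nq: "cmod q = (d - c) / 4"
    unfolding q_def norm_of_real using assms by simp
  have "(d - c) / 4 * cmod (1 - r) < (d - c) / 4 * cmod (1 + r)"
    using less assms by (intro mult_strict_left_mono) auto
  then show ?A
    using nz unfolding x norm_mult norm_divide nq by (simp add: pos_less_divide_eq)
  \<comment> \<open>Subtracting \<open>u - d = r^2 * (u - c)\<close> from \<open>u - c\<close> shows
    that \<open>q\<close> contains both factors \<open>1 - r\<close> and \<open>1 + r\<close>, which
    clears the denominators in the Joukowski sum.\<close>
  have "q * 4 = (1 - r\<^sup>2) * (u - of_real c)"
    using r2 dc by (simp add: algebra_simps)
  then have qq: "q = (1 - r) * (1 + r) * (u - of_real c) / 4"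
    by (simp add: power2_eq_square algebra_simps)
  have "q * (1 + r) / (1 - r) + q\<^sup>2 / (q * (1 + r) / (1 - r)) = q * (1 + r) / (1 - r) + q * (1 - r) / (1 + r)"
    using q nz by (simp add: power2_eq_square)
  also have "\<dots> = (1 + r)\<^sup>2 * (u - of_real c) / 4 + (1 - r)\<^sup>2 * (u - of_real c) / 4"
  proof -
    have "e * f * v / 4 * f / e = f\<^sup>2 * v / 4" if "e \<noteq> 0" for e f v :: complex
      using that by (simp add: power2_eq_square)
    from this [OF nz(1), of "1 + r" "u - of_real c"] this [OF nz(2), of "1 - r" "u - of_real c"]
    show ?thesis
      unfolding qq by (simp only: mult.commute [of "1 - r" "1 + r"])
  qed
  also have "\<dots> = ((u - of_real c) + r\<^sup>2 * (u - of_real c)) / 2"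
    by (simp add: power2_eq_square field_simps)
  also have "\<dots> = u - of_real ((c + d) / 2)"
    unfolding r2 [symmetric] by (simp add: field_simps)
  finally show ?B
    unfolding x q_def .
qed

text \<open>The construction runs backwards: \<open>r = (x - q) / (x + q)\<close> lies in the right
  half-plane since \<open>cmod x > q\<close>. The equation gives
  \<open>u - c = (x + q)^2 / x\<close> and \<open>u - d = (x - q)^2 / x\<close>, so the ratio is
  \<open>r^2\<close> and \<open>csqrt\<close> returns \<open>r\<close>, not
  \<open>- r\<close>.\<close>

lemma slit_coord_unique:
  fixes c d :: real
  assumes "c < d" and x: "cmod x > (d - c) / 4"
    and eq: "x + (of_real ((d - c) / 4))\<^sup>2 / x = u - of_real ((c + d) / 2)"
  shows "u \<notin> of_real ` {c..d}" "slit_coord c d u = x"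
proof -
  define q :: complex where "q = of_real ((d - c) / 4)"
  define r where "r = (x - q) / (x + q)"
  have dc: "of_real d = of_real c + 4 * q"
    by (simp add: q_def field_simps)
  have q: "q \<noteq> 0"
    using assms by (auto simp: q_def)
  have nq: "cmod q = (d - c) / 4"
    unfolding q_def norm_of_real using assms by simp
  have "x \<noteq> 0"
    using assms by auto
  have "x + q \<noteq> 0"
    using x nq by (metis add_eq_0_iff norm_minus_cancel less_irrefl)
  have r: "1 - r = 2 * q / (x + q)" "1 + r = 2 * x / (x + q)"
    using \<open>x + q \<noteq> 0\<close> by (simp_all add: r_def field_simps)
  have "cmod (1 - r) < cmod (1 + r)"
    using x nq \<open>x + q \<noteq> 0\<close> unfolding r norm_mult norm_divide by (simp add: divide_strict_right_mono)
  then have "Re r > 0"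
    by (simp add: cmod_one_minus_less_iff)
  have "of_real ((c + d) / 2) = of_real c + 2 * q"
    by (simp add: q_def field_simps)
  then have "x + q\<^sup>2 / x = u - (of_real c + 2 * q)"
    using eq unfolding q_def by metis
  then have u: "u = x + q\<^sup>2 / x + of_real c + 2 * q"
    by (simp add: algebra_simps)
  have "u - of_real c = (x + q)\<^sup>2 / x" "u - of_real d = (x - q)\<^sup>2 / x"
    using \<open>x \<noteq> 0\<close> unfolding u dc by (simp_all add: field_simps power2_eq_square)
  then have ratio: "(u - of_real d) / (u - of_real c) = r\<^sup>2"
    using \<open>x \<noteq> 0\<close> by (simp add: r_def power_divide)
  then have sqrt: "csqrt ((u - of_real d) / (u - of_real c)) = r"
    using \<open>Re r > 0\<close> by (simp add: csqrt_square)
  have "q * (1 + r) / (1 - r) = x"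
    unfolding r using \<open>x + q \<noteq> 0\<close> q by simp
  then show "slit_coord c d u = x"
    unfolding slit_coord_def Let_def sqrt q_def [symmetric] .
  show "u \<notin> of_real ` {c..d}"
  proof
    assume "u \<in> of_real ` {c..d}"
    then obtain v where v: "u = of_real v" "c \<le> v" "v \<le> d"
      by auto
    then have "(u - of_real d) / (u - of_real c) = of_real ((v - d) / (v - c))"
      by simp
    \<comment> \<open>At \<open>v = c\<close> the quotient is \<open>0\<close> by the convention for
      division by zero, so this endpoint is covered too.\<close>
    moreover have "(v - d) / (v - c) \<le> 0"
      using v by (simp add: divide_le_0_iff)
    ultimately have "r\<^sup>2 \<in> \<real>\<^sub>\<le>\<^sub>0"
      unfolding ratio by (metis nonpos_Reals_of_real_iff)
    then show False
      using Re_pos_square_notin_nonpos_Reals \<open>Re r > 0\<close> by blast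
  qed
qed

lemma holomorphic_on_slit_coord:
  fixes c d :: real
  assumes "c < d"
  shows "slit_coord c d holomorphic_on - of_real ` {c..d}"
proof -
  \<comment> \<open>This is the denominator of \<open>slit_coord\<close>; its vanishing would force
    \<open>c = d\<close>.\<close>
  have "csqrt ((u - of_real d) / (u - of_real c)) \<noteq> 1" if "u \<notin> of_real ` {c..d}" for u
  proof
    assume "csqrt ((u - of_real d) / (u - of_real c)) = 1"
    then have "(u - of_real d) / (u - of_real c) = 1"
      by (metis power2_csqrt power_one)
    with \<open>c < d\<close> show False
      by (auto simp: divide_eq_1_iff)
  qed
  then show ?thesis
    unfolding slit_coord_def Let_def
    using slit_ratio_notin_nonpos_Reals [OF assms]
    by (intro holomorphic_intros) (use assms in auto)
qed

section \<open>The lemniscatic map of radial slits\<close>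

lemma powr_inverse_nat_power:
  fixes h :: complex
  assumes "n > 0" "h \<noteq> 0"
  shows "(h powr (1 / of_nat n)) ^ n = h"
  using assms by (simp add: powr_def flip: exp_of_nat_mult)

text \<open>Off the cut \<open>Ln (inverse h) = - Ln h\<close>. This moves the reciprocal of the
  base into the sign of the exponent without changing the branch.\<close>

lemma complex_inverse_powr:
  fixes h a :: complex
  assumes "h \<notin> \<real>\<^sub>\<le>\<^sub>0"
  shows "inverse h powr a = h powr (- a)"
proof -
  have "h \<noteq> 0"
    using assms by auto
  then show ?thesis
    using assms by (simp add: powr_def Ln_inverse)
qed

lemma bigo_tendsto_zero:
  fixes f g :: "'a \<Rightarrow> complex"
  assumes "f \<in> O[F](g)" "(g \<longlongrightarrow> 0) F"
  shows "(f \<longlongrightarrow> 0) F"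
proof -
  have "g \<in> o[F](\<lambda>_. 1 :: complex)"
    using assms by (intro smalloI_tendsto) auto
  then have "f \<in> o[F](\<lambda>_. 1 :: complex)"
    using assms landau_o.big_small_trans by blast
  then show ?thesis
    using smalloD_tendsto by fastforce
qed

text \<open>Differentiability of \<open>(1 + y) powr a\<close> at \<open>y = 0\<close> bounds the
  difference quotient; then \<open>y = f x\<close> is substituted.\<close>

lemma powr_minus_one_bigo:
  fixes a :: complex and f :: "'a \<Rightarrow> complex"
  assumes "(f \<longlongrightarrow> 0) F"
  shows "(\<lambda>x. (1 + f x) powr a - 1) \<in> O[F](f)"
proof -
  have "((\<lambda>y. (1 + y) powr a) has_field_derivative a) (at 0)"
    by (auto intro!: derivative_eq_intros)
  then have "((\<lambda>y. ((1 + y) powr a - 1) / y) \<longlongrightarrow> a) (at 0)"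
    by (simp add: has_field_derivative_iff)
  then have "(\<lambda>y. (1 + y) powr a - 1) \<in> O[at 0](\<lambda>y. y)"
    by (rule bigoI_tendsto) (auto simp: eventually_at_filter)
  then obtain K where "K > 0" "\<forall>\<^sub>F y in at 0. cmod ((1 + y) powr a - 1) \<le> K * cmod y"
    by (auto elim: landau_o.bigE)
  \<comment> \<open>The bound also holds at \<open>y = 0\<close>, where both sides vanish; this is
    needed because \<open>f\<close> may take the value \<open>0\<close>.\<close>
  then have "\<forall>\<^sub>F y in nhds 0. cmod ((1 + y) powr a - 1) \<le> K * cmod y"
    by (auto simp: eventually_at_filter elim!: eventually_mono)
  then have "\<forall>\<^sub>F x in F. cmod ((1 + f x) powr a - 1) \<le> K * cmod (f x)"
    using assms by (rule eventually_compose_filterlim)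
  then show ?thesis
    by (rule bigoI)
qed

locale radial_slits =
  fixes n :: nat and C D :: real
  assumes n: "n \<ge> 2" and C: "0 < C" and CD: "C < D"
begin

text \<open>The \<open>n\<close>-th roots of \<open>A\<close> are the foci of the lemniscate,
  \<open>B\<close> is the coefficient in the inverse map, and \<open>q\<close> is the
  \<open>n\<close>-th power of the level \<open>\<mu>\<close>.\<close>

definition A :: real where "A = (sqrt D ^ n + sqrt C ^ n)\<^sup>2 / 4"
definition B :: real where "B = (sqrt D ^ n - sqrt C ^ n)\<^sup>2 / 4"
definition q :: real where "q = (D ^ n - C ^ n) / 4"

lemma power_less: "C ^ n < D ^ n"
  using n C CD by (intro power_strict_mono) auto

lemma sqrt_power_square: "(sqrt D ^ n)\<^sup>2 = D ^ n" "(sqrt C ^ n)\<^sup>2 = C ^ n"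
proof -
  have "(sqrt x ^ n)\<^sup>2 = x ^ n" if "x \<ge> 0" for x
    using that by (metis mult.commute power_mult real_sqrt_pow2)
  then show "(sqrt D ^ n)\<^sup>2 = D ^ n" "(sqrt C ^ n)\<^sup>2 = C ^ n"
    using C CD by auto
qed

lemma A_plus_B: "A + B = (C ^ n + D ^ n) / 2"
  unfolding A_def B_def
  by (simp add: field_simps flip: sqrt_power_square) (simp add: power2_eq_square algebra_simps)

lemma A_minus_B: "A - B = sqrt D ^ n * sqrt C ^ n"
  unfolding A_def B_def by (simp add: power2_eq_square field_simps)

lemma A_times_B: "A * B = q\<^sup>2"
  unfolding A_def B_def q_def
  by (simp flip: sqrt_power_square) (simp add: power2_eq_square algebra_simps)

text \<open>With \<open>a = sqrt D ^ n\<close> and \<open>b = sqrt C ^ n\<close> the numbers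
  \<open>B\<close>, \<open>q\<close>, \<open>A\<close> are \<open>(a - b)^2 / 4\<close>,
  \<open>(a - b) * (a + b) / 4\<close>, \<open>(a + b)^2 / 4\<close>, and
  \<open>0 < a - b < a + b\<close>.\<close>

lemma bounds: "0 < B" "B < q" "q < A" "0 < q"
proof -
  have "sqrt C ^ n < sqrt D ^ n" "0 < sqrt C ^ n"
    using n C CD by (auto intro!: power_strict_mono)
  moreover have "q = (sqrt D ^ n - sqrt C ^ n) * (sqrt D ^ n + sqrt C ^ n) / 4"
    unfolding q_def by (simp flip: sqrt_power_square) (simp add: power2_eq_square algebra_simps)
  ultimately show "0 < B" "B < q" "q < A"
    by (auto simp: A_def B_def power2_eq_square
      intro!: divide_strict_right_mono mult_strict_left_mono mult_strict_right_mono)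
  show "0 < q"
    using power_less by (simp add: q_def)
qed

section \<open>The map and its inverse in the Joukowski coordinate\<close>

abbreviation X :: "complex \<Rightarrow> complex" where
  "X z \<equiv> slit_coord (C ^ n) (D ^ n) (z ^ n)"

text \<open>This form mentions no branch \<open>s\<close> and has no exceptional point at
  \<open>z = 0\<close>. The exponent is negative because \<open>1 + B / X z\<close> is the
  reciprocal of the radicand in \<open>slit_Phi\<close>.\<close>

definition Phi :: "complex \<Rightarrow> complex" where
  "Phi z = z * (1 + of_real B / X z) powr (- 1 / of_nat n)"

definition Psi :: "complex \<Rightarrow> complex" where
  "Psi w = w * (1 + of_real B / (w ^ n - of_real A)) powr (1 / of_nat n)"

lemma mem_slits: "z \<in> slits n C D \<longleftrightarrow> z ^ n \<in> of_real ` {C ^ n..D ^ n}"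
  using n C CD by (intro mem_slits_iff) auto

lemma cmod_X: "z \<notin> slits n C D \<Longrightarrow> cmod (X z) > q"
  unfolding q_def by (intro cmod_slit_coord power_less) (simp add: mem_slits)

lemma joukowski_factor:
  fixes u x :: complex
  assumes "x \<noteq> 0"
  shows "x + (of_real q)\<^sup>2 / x = u - (of_real A + of_real B) \<longleftrightarrow>
    u = (x + of_real A) * (1 + of_real B / x)"
proof -
  have "(of_real q)\<^sup>2 = complex_of_real A * of_real B"
    by (simp flip: A_times_B of_real_mult of_real_power)
  then have "(x + of_real A) * (1 + of_real B / x) = x + (of_real q)\<^sup>2 / x + (of_real A + of_real B)"
    using assms by (simp add: field_simps)
  then show ?thesis
    by (auto simp: algebra_simps)
qed

lemma midpoint: "complex_of_real ((C ^ n + D ^ n) / 2) = of_real A + of_real B"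
  by (simp only: A_plus_B flip: of_real_add)

lemma joukowski_X:
  "z \<notin> slits n C D \<Longrightarrow> X z + (of_real q)\<^sup>2 / X z = z ^ n - (of_real A + of_real B)"
  unfolding mem_slits q_def midpoint [symmetric] by (rule joukowski_slit_coord [OF power_less])

lemma X_nonzero: "z \<notin> slits n C D \<Longrightarrow> X z \<noteq> 0"
  using cmod_X bounds by fastforce

lemma power_eq_X:
  assumes "z \<notin> slits n C D"
  shows "z ^ n = (X z + of_real A) * (1 + of_real B / X z)"
  using joukowski_factor [OF X_nonzero] joukowski_X assms by blast

text \<open>The converse of \<open>power_eq_X\<close>: the factorisation together with
  \<open>cmod x > q\<close> identifies \<open>x\<close>. It serves to recognise the coordinate of
  \<open>Psi w\<close> and the branch \<open>s\<close>.\<close>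

lemma X_unique:
  assumes "cmod x > q" "z ^ n = (x + of_real A) * (1 + of_real B / x)"
  shows "z \<notin> slits n C D" "X z = x"
proof -
  have "x \<noteq> 0"
    using assms bounds by auto
  then have "x + (of_real q)\<^sup>2 / x = z ^ n - of_real ((C ^ n + D ^ n) / 2)"
    unfolding midpoint using assms joukowski_factor by blast
  then show "z \<notin> slits n C D" "X z = x"
    using slit_coord_unique [OF power_less assms(1) [unfolded q_def]] unfolding mem_slits q_def by blast+
qed

lemma one_plus_notin_nonpos_Reals:
  assumes "cmod x > q"
  shows "1 + of_real B / x \<notin> \<real>\<^sub>\<le>\<^sub>0" "1 + of_real B / x \<noteq> 0"
proof -
  have "cmod (of_real B / x) < 1"
    using assms bounds by (simp add: norm_divide divide_less_eq)
  then have "Re (1 + of_real B / x) > 0"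
    using abs_Re_le_cmod [of "of_real B / x"] by simp
  then show "1 + of_real B / x \<notin> \<real>\<^sub>\<le>\<^sub>0"
    by (auto simp: complex_nonpos_Reals_iff)
  then show "1 + of_real B / x \<noteq> 0"
    by auto
qed

text \<open>The \<open>n\<close>-th power undoes the root, and the resulting reciprocal cancels the
  second factor in \<open>power_eq_X\<close>. Thus \<open>cmod (X z) > q\<close> turns into the
  lemniscatic condition on \<open>Phi z\<close>.\<close>

lemma Phi_power:
  assumes "z \<notin> slits n C D"
  shows "Phi z ^ n - of_real A = X z"
proof -
  let ?h = "1 + of_real B / X z"
  have "?h \<noteq> 0"
    using one_plus_notin_nonpos_Reals cmod_X assms by blast
  have "(?h powr (- 1 / of_nat n)) ^ n = inverse ((?h powr (1 / of_nat n)) ^ n)"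
    using powr_minus [of ?h "1 / of_nat n"] by (simp add: power_inverse)
  also have "\<dots> = inverse ?h"
    using n \<open>?h \<noteq> 0\<close> by (subst powr_inverse_nat_power) auto
  finally have "Phi z ^ n = z ^ n * inverse ?h"
    by (simp add: Phi_def power_mult_distrib)
  also have "\<dots> = (X z + of_real A) * ?h * inverse ?h"
    by (rule arg_cong [OF power_eq_X [OF assms], of "\<lambda>u. u * inverse ?h"])
  also have "\<dots> = X z + of_real A"
    using \<open>?h \<noteq> 0\<close> by simp
  finally show ?thesis by simp
qed

lemma Psi_power:
  assumes "cmod (w ^ n - of_real A) > q"
  shows "Psi w \<notin> slits n C D" "X (Psi w) = w ^ n - of_real A"
proof -
  let ?h = "1 + of_real B / (w ^ n - of_real A)"
  have "?h \<noteq> 0"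
    using one_plus_notin_nonpos_Reals assms by blast
  then have "Psi w ^ n = (w ^ n - of_real A + of_real A) * ?h"
    using n by (simp add: Psi_def power_mult_distrib powr_inverse_nat_power)
  then show "Psi w \<notin> slits n C D" "X (Psi w) = w ^ n - of_real A"
    using X_unique assms by blast+
qed

text \<open>By \<open>Phi_power\<close> the base in \<open>Psi\<close> at \<open>Phi z\<close> is
  the same \<open>?h\<close> as in \<open>Phi z\<close>; its powers with opposite exponents
  cancel.\<close>

lemma Psi_Phi:
  assumes "z \<notin> slits n C D"
  shows "Psi (Phi z) = z"
proof -
  let ?h = "1 + of_real B / X z"
  have "?h \<noteq> 0"
    using one_plus_notin_nonpos_Reals cmod_X assms by blast
  then show ?thesis
    using powr_minus [of ?h "1 / of_nat n"]
    by (simp add: Psi_def Phi_power [OF assms]) (simp add: Phi_def)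
qed

lemma Phi_Psi:
  assumes "cmod (w ^ n - of_real A) > q"
  shows "Phi (Psi w) = w"
proof -
  let ?h = "1 + of_real B / (w ^ n - of_real A)"
  have "?h \<noteq> 0"
    using one_plus_notin_nonpos_Reals assms by blast
  then show ?thesis
    using powr_minus [of ?h "1 / of_nat n"]
    by (simp add: Phi_def Psi_power [OF assms]) (simp add: Psi_def)
qed

lemma bij_betw_Phi: "bij_betw Phi (- slits n C D) {w. cmod (w ^ n - of_real A) > q}"
  by (rule bij_betw_byWitness [where f' = Psi])
    (auto simp: Psi_Phi Phi_Psi Phi_power cmod_X Psi_power)

lemma holomorphic_X: "X holomorphic_on - slits n C D"
proof -
  have "(slit_coord (C ^ n) (D ^ n) \<circ> (\<lambda>z. z ^ n)) holomorphic_on - slits n C D"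
    by (intro holomorphic_on_compose_gen [OF _ holomorphic_on_slit_coord] holomorphic_intros power_less)
      (auto simp: mem_slits)
  then show ?thesis
    by (simp add: o_def)
qed

lemma holomorphic_Phi: "Phi holomorphic_on - slits n C D"
proof -
  show ?thesis
    unfolding Phi_def
    by (intro holomorphic_intros holomorphic_X)
      (use X_nonzero one_plus_notin_nonpos_Reals cmod_X in auto)
qed

section \<open>Behaviour at infinity\<close>

lemma eventually_notin_slits: "\<forall>\<^sub>F z in at_infinity. z \<notin> slits n C D"
proof -
  obtain M where M: "\<And>z. z \<in> slits n C D \<Longrightarrow> cmod z < M"
    using compact_imp_bounded [OF compact_slits] bounded_pos_less by metis
  have "\<forall>\<^sub>F z::complex in at_infinity. cmod z \<ge> M"
    unfolding eventually_at_infinity by blast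
  then show ?thesis
    by (rule eventually_mono) (use M in force)
qed

text \<open>As \<open>X z\<close> grows like \<open>z ^ n\<close> and \<open>n \<ge> 2\<close>, the
  term \<open>B / X z\<close> is of order \<open>1 / z^2\<close>. The power inherits this order, and
  the factor \<open>z\<close> costs one degree.\<close>

lemma Phi_expansion: "(\<lambda>z. Phi z - z) \<in> O[at_infinity](\<lambda>z. 1 / z)"
proof -
  \<comment> \<open>\<open>K\<close> collects the midpoint and the bound \<open>q\<close> for the
    modulus of \<open>q^2 / X z\<close>, so that
    \<open>cmod z ^ n \<le> K + cmod (X z)\<close>.\<close>
  define K where "K = cmod (of_real ((C ^ n + D ^ n) / 2)) + q"
  have "K > 0"
    unfolding K_def using bounds by (intro add_nonneg_pos) auto
  have *: "cmod (of_real B / X z) \<le> 2 * B * cmod (1 / z ^ 2)"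
    if z: "cmod z \<ge> max (2 * K + 1) 1" "z \<notin> slits n C D" for z
  proof -
    have "cmod (X z) > q"
      using cmod_X z by blast
    have "cmod z ^ 2 \<le> cmod z ^ n" "cmod z ^ 1 \<le> cmod z ^ n"
      using n z power_increasing [of 1 n "cmod z"] power_increasing [of 2 n "cmod z"] by auto
    have "z ^ n - of_real ((C ^ n + D ^ n) / 2) = X z + (of_real q)\<^sup>2 / X z"
      unfolding midpoint using joukowski_X [OF z(2)] by (rule sym)
    then have "cmod (z ^ n - of_real ((C ^ n + D ^ n) / 2)) \<le> cmod (X z) + cmod ((of_real q)\<^sup>2 / X z)"
      by (simp only: norm_triangle_ineq)
    then have "cmod (z ^ n) \<le>
        cmod (of_real ((C ^ n + D ^ n) / 2)) + cmod (X z) + cmod ((of_real q)\<^sup>2 / X z)"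
      using norm_triangle_ineq2 [of "z ^ n" "of_real ((C ^ n + D ^ n) / 2)"] by linarith
    moreover have "cmod ((of_real q)\<^sup>2 / X z) \<le> q"
      using \<open>cmod (X z) > q\<close> bounds by (simp add: norm_divide norm_mult power2_eq_square divide_le_eq)
    ultimately have "cmod z ^ n \<le> K + cmod (X z)"
      by (simp add: K_def norm_power)
    \<comment> \<open>The threshold \<open>2 * K + 1\<close> gives
      \<open>K \<le> cmod z / 2\<close>, which is at most half of \<open>cmod z ^ n\<close>.\<close>
    then have "cmod z ^ 2 \<le> 2 * cmod (X z)"
      using \<open>cmod z ^ 2 \<le> cmod z ^ n\<close> \<open>cmod z ^ 1 \<le> cmod z ^ n\<close> z by simp
    moreover have "cmod z > 0" "cmod (X z) > 0"
      using z bounds \<open>cmod (X z) > q\<close> by auto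
    ultimately have "1 / cmod (X z) \<le> 2 / cmod z ^ 2"
      by (simp add: field_simps)
    then have "B * (1 / cmod (X z)) \<le> B * (2 / cmod z ^ 2)"
      using bounds by (intro mult_left_mono) auto
    then show ?thesis
      using bounds by (simp add: norm_divide norm_power mult.commute)
  qed
  have "\<forall>\<^sub>F z::complex in at_infinity. cmod z \<ge> max (2 * K + 1) 1"
    unfolding eventually_at_infinity by blast
  then have "\<forall>\<^sub>F z in at_infinity. cmod (of_real B / X z) \<le> 2 * B * cmod (1 / z ^ 2)"
    using eventually_notin_slits by eventually_elim (rule *)
  then have X: "(\<lambda>z. of_real B / X z) \<in> O[at_infinity](\<lambda>z. 1 / z ^ 2)"
    by (rule bigoI)
  have "((\<lambda>z::complex. 1 / z ^ 2) \<longlongrightarrow> 0) at_infinity"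
    by (intro tendsto_divide_0 [OF tendsto_const] filterlim_power_at_infinity filterlim_ident) auto
  then have "((\<lambda>z. of_real B / X z) \<longlongrightarrow> 0) at_infinity"
    by (rule bigo_tendsto_zero [OF X])
  then have "(\<lambda>z. (1 + of_real B / X z) powr (- 1 / of_nat n) - 1) \<in> O[at_infinity](\<lambda>z. 1 / z ^ 2)"
    by (intro landau_o.big_trans [OF powr_minus_one_bigo X])
  then have "(\<lambda>z. z * ((1 + of_real B / X z) powr (- 1 / of_nat n) - 1)) \<in> O[at_infinity](\<lambda>z. z * (1 / z ^ 2))"
    by (intro landau_o.big.mult) auto
  moreover have "(\<lambda>z::complex. z * (1 / z ^ 2)) = (\<lambda>z. 1 / z)"
    by (simp add: fun_eq_iff power2_eq_square)
  moreover have "(\<lambda>z. Phi z - z) = (\<lambda>z. z * ((1 + of_real B / X z) powr (- 1 / of_nat n) - 1))"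
    by (simp add: fun_eq_iff Phi_def algebra_simps)
  ultimately show ?thesis
    by (simp only:)
qed

lemma filterlim_Phi: "filterlim Phi at_infinity at_infinity"
proof -
  have "((\<lambda>z::complex. 1 / z) \<longlongrightarrow> 0) at_infinity"
    by (intro tendsto_divide_0 [OF tendsto_const] filterlim_ident)
  then have "((\<lambda>z. Phi z - z) \<longlongrightarrow> 0) at_infinity"
    by (rule bigo_tendsto_zero [OF Phi_expansion])
  then have "filterlim (\<lambda>z. (Phi z - z) + z) at_infinity at_infinity"
    by (rule tendsto_add_filterlim_at_infinity) (rule filterlim_ident)
  then show ?thesis by simp
qed

section \<open>The branch of the square root\<close>

lemma normalized_branch_eq:
  fixes u t :: complex
  shows "of_real (2 / (D ^ n - C ^ n)) * (u - of_real ((D ^ n + C ^ n) / 2) + t) =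
    (u - (of_real A + of_real B) + t) / 2 / of_real q"
proof -
  have scale: "2 / (D ^ n - C ^ n) = 1 / (2 * q)"
    using power_less by (simp add: q_def field_simps)
  have mid: "of_real ((D ^ n + C ^ n) / 2) = complex_of_real A + of_real B"
    using midpoint by (simp only: add.commute)
  show ?thesis
    unfolding scale mid by simp
qed

text \<open>With \<open>m\<close> the midpoint,
  \<open>(z ^ n - C ^ n) * (z ^ n - D ^ n) = (z ^ n - m)^2 - 4 * q^2\<close>, so \<open>x\<close>
  solves the Joukowski quadratic for either sign of the root. The modulus condition says
  \<open>cmod x > q\<close> and selects the solution \<open>X z\<close>.\<close>

lemma slit_branch_imp_X:
  assumes "slit_branch n C D s" "z \<notin> slits n C D"
  shows "s z = 2 * X z - (z ^ n - of_real ((C ^ n + D ^ n) / 2))"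
proof -
  let ?m = "of_real ((C ^ n + D ^ n) / 2) :: complex"
  define x where "x = (z ^ n - ?m + s z) / 2"
  have s2: "(s z)\<^sup>2 = (z ^ n - of_real (C ^ n)) * (z ^ n - of_real (D ^ n))"
    and less: "cmod (of_real (2 / (D ^ n - C ^ n)) * (z ^ n - of_real ((D ^ n + C ^ n) / 2) + s z)) > 1"
    using assms by (auto simp: slit_branch_def)
  have "of_real (2 / (D ^ n - C ^ n)) * (z ^ n - of_real ((D ^ n + C ^ n) / 2) + s z) = x / of_real q"
    unfolding x_def midpoint by (rule normalized_branch_eq)
  then have x: "cmod x > q"
    using less bounds by (simp add: norm_divide)
  then have "x \<noteq> 0"
    using bounds by auto
  have "x\<^sup>2 + (of_real q)\<^sup>2 = x * (z ^ n - ?m)"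
  proof -
    have "4 * (x\<^sup>2 + (of_real q)\<^sup>2 - x * (z ^ n - ?m)) = (s z)\<^sup>2 - (z ^ n - ?m)\<^sup>2 + 4 * (of_real q)\<^sup>2"
      by (simp add: x_def power2_eq_square field_simps)
    also have "\<dots> = 0"
      unfolding s2 by (simp add: q_def power2_eq_square field_simps)
    finally show ?thesis
      unfolding mult_eq_0_iff right_minus_eq by simp
  qed
  then have "x + (of_real q)\<^sup>2 / x = z ^ n - ?m"
    using \<open>x \<noteq> 0\<close> by (simp add: field_simps power2_eq_square)
  then have "X z = x"
    using X_unique x joukowski_factor [OF \<open>x \<noteq> 0\<close>] unfolding midpoint by blast
  then show ?thesis
    by (simp add: x_def field_simps)
qed

text \<open>The witness is the formula forced by \<open>slit_branch_imp_X\<close>, which is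
  holomorphic because \<open>X\<close> is.\<close>

lemma slit_branch_exists: "\<exists>s. slit_branch n C D s"
proof -
  let ?m = "of_real ((C ^ n + D ^ n) / 2) :: complex"
  let ?s = "\<lambda>z. 2 * X z - (z ^ n - ?m)"
  have "?s holomorphic_on - slits n C D"
    by (intro holomorphic_intros holomorphic_X)
  moreover have "(?s z)\<^sup>2 = (z ^ n - of_real (C ^ n)) * (z ^ n - of_real (D ^ n))"
    if "z \<notin> slits n C D" for z
  proof -
    have "X z \<noteq> 0"
      using X_nonzero that by blast
    moreover have "X z + (of_real q)\<^sup>2 / X z = z ^ n - ?m"
      unfolding midpoint using joukowski_X [OF that] .
    ultimately have "(X z)\<^sup>2 + (of_real q)\<^sup>2 = X z * (z ^ n - ?m)"
      by (simp add: field_simps power2_eq_square)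
    \<comment> \<open>Completing the square turns the quadratic for \<open>X z\<close> into its
      discriminant.\<close>
    moreover have "(2 * x - t)\<^sup>2 = t\<^sup>2 - 4 * p\<^sup>2" if "x\<^sup>2 + p\<^sup>2 = x * t" for x t p :: complex
    proof -
      have "(2 * x - t)\<^sup>2 = t\<^sup>2 + 4 * (x\<^sup>2 - x * t)"
        by (simp add: power2_eq_square algebra_simps)
      then show ?thesis
        by (simp flip: that)
    qed
    ultimately have "(?s z)\<^sup>2 = (z ^ n - ?m)\<^sup>2 - 4 * (of_real q)\<^sup>2"
      by blast
    also have "\<dots> = (z ^ n - of_real (C ^ n)) * (z ^ n - of_real (D ^ n))"
      by (simp add: q_def power2_eq_square field_simps)
    finally show ?thesis .
  qed
  moreover have "cmod (of_real (2 / (D ^ n - C ^ n)) * (z ^ n - of_real ((D ^ n + C ^ n) / 2) + ?s z)) > 1"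
    if "z \<notin> slits n C D" for z
  proof -
    have "of_real (2 / (D ^ n - C ^ n)) * (z ^ n - of_real ((D ^ n + C ^ n) / 2) + ?s z) = X z / of_real q"
      unfolding normalized_branch_eq midpoint by simp
    then show ?thesis
      using cmod_X [OF that] bounds by (simp add: norm_divide)
  qed
  ultimately show ?thesis
    unfolding slit_branch_def by blast
qed

section \<open>From the explicit formulas to a conformal bijection\<close>

text \<open>Inserting the value of \<open>s z\<close> makes the radicand
  \<open>(X z + A) / z ^ n\<close>, which is the reciprocal of \<open>1 + B / X z\<close> by
  \<open>power_eq_X\<close>.\<close>

lemma slit_Phi_finite_eq:
  assumes s: "slit_branch n C D s" and z: "z \<notin> slits n C D"
  shows "z * (1 / 2 + of_real (sqrt D ^ n * sqrt C ^ n / 2) * (1 / z ^ n) + 1 / (2 * z ^ n) * s z)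
    powr (1 / of_nat n) = Phi z"
proof -
  let ?h = "1 + of_real B / X z"
  have h: "?h \<notin> \<real>\<^sub>\<le>\<^sub>0" "?h \<noteq> 0"
    using one_plus_notin_nonpos_Reals cmod_X z by blast+
  have "1 / 2 + of_real (sqrt D ^ n * sqrt C ^ n / 2) * (1 / z ^ n) + 1 / (2 * z ^ n) * s z = inverse ?h"
    if "z \<noteq> 0"
  proof -
    have s: "s z = 2 * X z - (z ^ n - (of_real A + of_real B))"
      using slit_branch_imp_X [OF s z] unfolding midpoint .
    have "1 / 2 + of_real (sqrt D ^ n * sqrt C ^ n / 2) * (1 / z ^ n) + 1 / (2 * z ^ n) * s z
        = (z ^ n + (of_real A - of_real B) + s z) / (2 * z ^ n)"
      using that unfolding A_minus_B [symmetric] by (simp add: field_simps)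
    also have "\<dots> = (X z + of_real A) / z ^ n"
      unfolding s using that by (simp add: field_simps)
    also have "\<dots> = inverse ?h"
    proof -
      have "z ^ n * inverse ?h = (X z + of_real A) * ?h * inverse ?h"
        by (rule arg_cong [OF power_eq_X [OF z], of "\<lambda>u. u * inverse ?h"])
      also have "\<dots> = X z + of_real A"
        using h(2) by simp
      finally show ?thesis
        using that by (metis nonzero_mult_div_cancel_left power_not_zero)
    qed
    finally show ?thesis .
  qed
  \<comment> \<open>At \<open>z = 0\<close> the radicand has only a default value, but the factor
    \<open>z\<close> makes both sides \<open>0\<close>.\<close>
  then show ?thesis
    using h by (cases "z = 0") (simp_all add: Phi_def complex_inverse_powr)
qed

text \<open>Agreement with \<open>Phi\<close> can be claimed only off the slits, since
  \<open>s\<close> is arbitrary on them.\<close>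

lemma slit_Phi_eq_map_option:
  assumes "slit_branch n C D s"
  obtains f where "slit_Phi n C D s = map_option f" "\<And>z. z \<notin> slits n C D \<Longrightarrow> f z = Phi z"
proof
  show "slit_Phi n C D s = map_option (\<lambda>z. z * (1 / 2 + of_real (sqrt D ^ n * sqrt C ^ n / 2) * (1 / z ^ n)
      + 1 / (2 * z ^ n) * s z) powr (1 / of_nat n))"
    by (rule slit_Phi_def)
qed (rule slit_Phi_finite_eq [OF assms])

lemma slit_Phi_inv_eq: "slit_Phi_inv n C D = map_option Psi"
  unfolding slit_Phi_inv_def
  by (rule arg_cong [of _ _ map_option]) (simp add: Psi_def A_def B_def fun_eq_iff)

lemma conformal_bij_slit_Phi:
  assumes "slit_branch n C D s"
  shows "conformal_bij (slit_Phi n C D s) (sphere_compl (slits n C D))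
    (insert None (Some ` {w. cmod (w ^ n - of_real A) > q}))"
proof -
  obtain f where f: "slit_Phi n C D s = map_option f" "\<And>z. z \<notin> slits n C D \<Longrightarrow> f z = Phi z"
    using slit_Phi_eq_map_option [OF assms] by blast
  have "f holomorphic_on - slits n C D"
    using f(2) by (intro holomorphic_transform [OF holomorphic_Phi]) auto
  moreover have "filterlim f at_infinity at_infinity"
  proof (rule filterlim_mono_eventually [OF filterlim_Phi order_refl order_refl])
    show "\<forall>\<^sub>F z in at_infinity. Phi z = f z"
      using eventually_notin_slits by (rule eventually_mono) (simp add: f)
  qed
  ultimately have "sphere_holomorphic_on (map_option f) (sphere_compl (slits n C D))"
    by (intro sphere_holomorphic_on_map_option compact_slits)
  moreover have "bij_betw f (- slits n C D) {w. cmod (w ^ n - of_real A) > q}"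
    using bij_betw_Phi f(2) bij_betw_cong [of "- slits n C D" f Phi] by simp
  then have "bij_betw (map_option f) (sphere_compl (slits n C D))
      (insert None (Some ` {w. cmod (w ^ n - of_real A) > q}))"
    unfolding sphere_compl_eq by (auto simp: bij_betw_def inj_on_def image_image)
  ultimately show ?thesis
    by (simp add: conformal_bij_def f)
qed

lemma slit_Phi_expansion:
  assumes "slit_branch n C D s"
  shows "(\<lambda>z. the (slit_Phi n C D s (Some z)) - z) \<in> O[at_infinity](\<lambda>z. 1 / z)"
proof -
  obtain f where f: "slit_Phi n C D s = map_option f" "\<And>z. z \<notin> slits n C D \<Longrightarrow> f z = Phi z"
    using slit_Phi_eq_map_option [OF assms] by blast
  have "\<forall>\<^sub>F z in at_infinity. the (slit_Phi n C D s (Some z)) - z = Phi z - z"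
    using eventually_notin_slits by (rule eventually_mono) (simp add: f)
  from landau_o.big.in_cong [OF this] Phi_expansion show ?thesis
    by (rule iffD2)
qed

text \<open>By injectivity it suffices that \<open>Psi\<close> lands off the slits and is mapped
  back to \<open>w\<close>.\<close>

lemma inv_into_slit_Phi:
  assumes "slit_branch n C D s" "w \<in> insert None (Some ` {w. cmod (w ^ n - of_real A) > q})"
  shows "inv_into (sphere_compl (slits n C D)) (slit_Phi n C D s) w = slit_Phi_inv n C D w"
proof (rule inv_into_f_eq)
  obtain f where f: "slit_Phi n C D s = map_option f" "\<And>z. z \<notin> slits n C D \<Longrightarrow> f z = Phi z"
    using slit_Phi_eq_map_option [OF assms(1)] by blast
  show "inj_on (slit_Phi n C D s) (sphere_compl (slits n C D))"
    using conformal_bij_slit_Phi [OF assms(1)] by (simp add: conformal_bij_def bij_betw_def)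
  show "slit_Phi_inv n C D w \<in> sphere_compl (slits n C D)"
    using assms(2) by (auto simp: slit_Phi_inv_eq sphere_compl_eq Psi_power)
  show "slit_Phi n C D s (slit_Phi_inv n C D w) = w"
    using assms(2) by (auto simp: slit_Phi_inv_eq f Psi_power Phi_Psi)
qed

section \<open>The components of the slit set and the foci\<close>

text \<open>Each piece is a linear image of an interval, hence compact and convex, and a bounded
  convex set in the plane has connected complement.\<close>

lemma slits_decomposition:
  "\<exists>Es :: nat \<Rightarrow> complex set.
     slits n C D = (\<Union>j<n. Es j) \<and>
     (\<forall>j<n. simply_connected_compact (Es j) \<and> Es j \<noteq> {} \<and> (\<nexists>p. Es j = {p})) \<and>
     (\<forall>i<n. \<forall>j<n. i \<noteq> j \<longrightarrow> Es i \<inter> Es j = {})"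
proof -
  define Es where "Es j = (\<lambda>x. cis (2 * pi * real j / real n) * of_real x) ` {C..D}" for j
  have "simply_connected_compact (Es j)" for j
  proof -
    let ?g = "\<lambda>x::real. cis (2 * pi * real j / real n) * of_real x"
    have "compact (Es j)"
      unfolding Es_def by (intro compact_continuous_image continuous_intros) auto
    moreover have "linear ?g"
      by (auto intro!: linearI simp: algebra_simps scaleR_conv_of_real)
    then have "convex (Es j)"
      unfolding Es_def by (intro convex_linear_image) auto
    ultimately show ?thesis
      unfolding simply_connected_compact_def
      by (intro conjI connectedin_sphere_compl connected_complement_bounded_convex)
        (auto intro: convex_connected compact_imp_bounded)
  qed
  moreover have "Es j \<noteq> {}" for j
    using CD by (simp add: Es_def)
  moreover have "Es j \<noteq> {p}" for j p
  proof
    let ?w = "cis (2 * pi * real j / real n)"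
    assume "Es j = {p}"
    moreover have "?w * of_real C \<in> Es j" "?w * of_real D \<in> Es j"
      using CD by (auto simp: Es_def)
    ultimately have "?w * of_real C = ?w * of_real D"
      by simp
    then show False
      using CD by simp
  qed
  moreover have "Es i \<inter> Es j = {}" if "i < n" "j < n" "i \<noteq> j" for i j
    unfolding Es_def using that C n by (intro disjoint_rotated_segments) auto
  moreover have "slits n C D = (\<Union>j<n. Es j)"
    unfolding Es_def using n by (intro slits_eq) auto
  ultimately show ?thesis
    by (intro exI [of _ Es]) simp
qed

text \<open>The foci enumerate the \<open>n\<close> distinct roots of \<open>A\<close> with equal
  weights \<open>1 / n\<close>, so the product of distances collapses by
  \<open>prod_diff_nth_roots\<close>.\<close>

lemma exists_foci:
  obtains a where "inj_on a {..<n}"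
    "\<And>w. abs_U n a (\<lambda>_. 1 / real n) w = cmod (w ^ n - of_real A) powr (1 / real n)"
proof -
  have n0: "n > 0"
    using n by simp
  have A0: "complex_of_real A \<noteq> 0"
    using bounds by simp
  have "finite {z. z ^ n = complex_of_real A}" "card {z. z ^ n = complex_of_real A} = n"
    using card_nth_roots [OF A0 n0] finite_nth_roots [OF n0] by auto
  then obtain a where a: "bij_betw a {..<n} {z. z ^ n = complex_of_real A}"
    using ex_bij_betw_nat_finite [of "{z. z ^ n = complex_of_real A}"] by (auto simp: lessThan_atLeast0)
  show ?thesis
  proof
    show "inj_on a {..<n}"
      using a by (rule bij_betw_imp_inj_on)
    fix w :: complex
    have "abs_U n a (\<lambda>_. 1 / real n) w = (\<Prod>j<n. cmod (w - a j)) powr (1 / real n)"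
      unfolding abs_U_def by (rule prod_powr_distrib [symmetric])
    also have "(\<Prod>j<n. cmod (w - a j)) = (\<Prod>z | z ^ n = of_real A. cmod (w - z))"
      by (rule prod.reindex_bij_betw [OF a])
    also have "\<dots> = cmod (w ^ n - of_real A)"
      using prod_diff_nth_roots [OF n0 A0, of w] by (simp add: prod_norm)
    finally show "abs_U n a (\<lambda>_. 1 / real n) w = cmod (w ^ n - of_real A) powr (1 / real n)" .
  qed
qed

end

text \<open>Existence of a branch is asserted separately, so that the claim about every branch is
  not vacuous. The foci are existentially quantified because their enumeration is arbitrary.\<close>

theorem corollary3p3:
  fixes n :: nat and C D :: real
  assumes "n \<ge> 2" and "0 < C" and "C < D"
  shows "(\<exists>s. slit_branch n C D s) \<and>
    (\<forall>s. slit_branch n C D s \<longrightarrow>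
      (let \<mu> = ((D ^ n - C ^ n) / 4) powr (1 / real n);
           L = insert None (Some ` {w :: complex.
                 cmod (w ^ n - of_real ((sqrt D ^ n + sqrt C ^ n)\<^sup>2 / 4)) powr (1 / real n) > \<mu>})
       in (\<exists>a m. (\<forall>w. abs_U n a m w =
                     cmod (w ^ n - of_real ((sqrt D ^ n + sqrt C ^ n)\<^sup>2 / 4)) powr (1 / real n)) \<and>
                 lemniscatic_domain n a m \<mu> = L \<and>
                 lemniscatic_map (slits n C D) n a m \<mu> (slit_Phi n C D s)) \<and>
          (\<forall>w\<in>L. inv_into (sphere_compl (slits n C D)) (slit_Phi n C D s) w
                   = slit_Phi_inv n C D w)))"
proof -
  interpret radial_slits n C D
    using assms by unfold_locales
  define \<mu> where "\<mu> = q powr (1 / real n)"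
  have \<mu>: "\<mu> > 0"
    using bounds by (simp add: \<mu>_def)
  \<comment> \<open>Monotonicity of the real root identifies the domain written with
    \<open>\<mu>\<close> with the image set found for \<open>Phi\<close>.\<close>
  have level: "cmod (w ^ n - of_real A) powr (1 / real n) > \<mu> \<longleftrightarrow> cmod (w ^ n - of_real A) > q" for w
  proof (cases "cmod (w ^ n - of_real A) > q")
    case True
    then show ?thesis
      unfolding \<mu>_def using bounds n by (simp add: powr_less_mono2)
  next
    case False
    then have "cmod (w ^ n - of_real A) powr (1 / real n) \<le> \<mu>"
      unfolding \<mu>_def by (intro powr_mono2) auto
    with False show ?thesis by simp
  qed
  obtain a where a: "inj_on a {..<n}"
    "\<And>w. abs_U n a (\<lambda>_. 1 / real n) w = cmod (w ^ n - of_real A) powr (1 / real n)"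
    using exists_foci by blast
  have domain: "lemniscatic_domain n a (\<lambda>_. 1 / real n) \<mu> =
      insert None (Some ` {w. cmod (w ^ n - of_real A) > q})"
    by (simp add: lemniscatic_domain_def a level)
  have params: "lemniscatic_params n a (\<lambda>_. 1 / real n) \<mu>"
    using a \<mu> n by (simp add: lemniscatic_params_def)
  show ?thesis
    unfolding Let_def A_def [symmetric] q_def [symmetric] \<mu>_def [symmetric] level
  proof (intro conjI allI impI ballI exI [of _ a] exI [of _ "\<lambda>_. 1 / real n"])
    show "\<exists>s. slit_branch n C D s"
      by (rule slit_branch_exists)
    fix s assume s: "slit_branch n C D s"
    show "abs_U n a (\<lambda>_. 1 / real n) w = cmod (w ^ n - of_real A) powr (1 / real n)" for w
      by (rule a)
    show "lemniscatic_domain n a (\<lambda>_. 1 / real n) \<mu> =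
        insert None (Some ` {w. cmod (w ^ n - of_real A) > q})"
      by (rule domain)
    show "lemniscatic_map (slits n C D) n a (\<lambda>_. 1 / real n) \<mu> (slit_Phi n C D s)"
      unfolding lemniscatic_map_def domain
    proof (intro conjI)
      show "slit_Phi n C D s None = None"
        by (simp add: slit_Phi_def)
    qed (rule slits_decomposition params conformal_bij_slit_Phi [OF s] slit_Phi_expansion [OF s])+
    show "inv_into (sphere_compl (slits n C D)) (slit_Phi n C D s) w = slit_Phi_inv n C D w"
      if "w \<in> insert None (Some ` {w. cmod (w ^ n - of_real A) > q})" for w
      using s that by (rule inv_into_slit_Phi)
  qed
qed

end
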